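(* Let $I\subseteq\mathbb{R}$ be an interval and let $h:(0,1)\to(0,\infty)$ be a function such that $h(1-\lambda)+h(\lambda)\geq1$ for all $\lambda\in(0,1)$. If $h$ is concave, then every nonnegative $h$-convex function $f:I\to\mathbb{R}$ satisfies $$\max\{h(1/2),\,2h(1/4)\}\,\big(f(x)+f(y)+f(z)\big)+2h(3/4)\,f\left(\frac{x+y+z}{3}\right)\ \geq\ f\left(\frac{x+y}{2}\right)+f\left(\frac{y+z}{2}\right)+f\left(\frac{z+x}{2}\right)$$ for all $x,y,z\in I$.
   Context: A function $f:I\to\mathbb{R}$ is called $h$-convex if $f((1-\lambda)x+\lambda y)\leq h(1-\lambda)f(x)+h(\lambda)f(y)$ for all $x,y\in I$ and all $\lambda\in(0,1)$. *)

theory Defs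
  imports "HOL-Analysis.Analysis"
begin

text \<open>Both \<^term>\<open>f\<close> and \<^term>\<open>h\<close> are total functions; only the values of \<^term>\<open>f\<close> on \<^term>\<open>I\<close>
  and of \<^term>\<open>h\<close> on the open unit interval enter (for convex \<^term>\<open>I\<close>).\<close>
definition h_convex_on :: "(real \<Rightarrow> real) \<Rightarrow> real set \<Rightarrow> (real \<Rightarrow> real) \<Rightarrow> bool" where
  "h_convex_on h I f \<longleftrightarrow>
     (\<forall>x\<in>I. \<forall>y\<in>I. \<forall>l\<in>{0<..<1}. f ((1 - l) * x + l * y) \<le> h (1 - l) * f x + h l * f y)"

end

theory Submission
  imports Defs
begin

text \<open>Let \<open>m\<close> be the mean of \<open>x, y, z\<close>. If \<open>x\<close> and \<open>y\<close> lie strictly on the same side of \<open>m\<close>,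
  then \<open>(x + z) / 2\<close> and \<open>(y + z) / 2\<close> lie strictly between \<open>m\<close> and \<open>z\<close>, with weights at \<open>m\<close>
  summing to \<open>3 / 2\<close>, and midpoint concavity of \<open>h\<close> bounds the resulting weights by \<open>2 * h (3 / 4)\<close>
  and \<open>2 * h (1 / 4)\<close>. Otherwise one of the points equals \<open>m\<close> and a weight degenerates to \<open>1\<close>,
  where \<open>h\<close> is not defined; there the inequality reduces to
  \<open>1 + 2 * h (1 / 2) \<le> 2 * (h (1 / 4) + h (3 / 4))\<close>, obtained by letting the argument of \<open>h\<close>
  approach the end points.\<close>

lemma concave_on_midpoint:
  fixes h :: "real \<Rightarrow> real"
  assumes "concave_on S h" "u \<in> S" "v \<in> S"
  shows "h u + h v \<le> 2 * h ((u + v) / 2)"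
proof -
  have "h ((1 / 2) *\<^sub>R u + (1 / 2) *\<^sub>R v) \<ge> (1 / 2) * h u + (1 / 2) * h v"
  proof -
    have "(1 / 2 :: real) \<ge> 0" "(1 / 2 :: real) + 1 / 2 = 1"
      by simp_all
    then show ?thesis
      using assms unfolding concave_on_iff by blast
  qed
  moreover have "(1 / 2) *\<^sub>R u + (1 / 2) *\<^sub>R v = (u + v) / 2"
    by (simp add: field_simps)
  ultimately have "(1 / 2) * h u + (1 / 2) * h v \<le> h ((u + v) / 2)"
    by (simp only:)
  then show ?thesis
    by argo
qed

text \<open>Formally, this adds midpoint concavity on the two halves of the unit interval to
  \<open>h 0 + h 1 \<ge> 1\<close>. Since \<open>h\<close> is constrained only inside, the end
  points become \<open>e\<close> and \<open>1 - e\<close>, and \<open>1 / 2\<close> becomes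
  \<open>1 / 2 - e\<close> or \<open>1 / 2 + e\<close>, which keeps the midpoints at
  \<open>1 / 4\<close> and \<open>3 / 4\<close>.\<close>

lemma concave_quarter_points:
  fixes h :: "real \<Rightarrow> real"
  assumes h_sum: "\<And>l. l \<in> {0<..<1} \<Longrightarrow> h (1 - l) + h l \<ge> 1"
    and conc: "concave_on {0<..<1} h"
  shows "1 + 2 * h (1 / 2) \<le> 2 * (h (1 / 4) + h (3 / 4))"
proof -
  define S where "S = h (1 / 4) + h (3 / 4)"
  have approx: "1 + (2 - 8 * e) * h (1 / 2) \<le> (2 - 4 * e) * S" if e: "e \<in> {0<..<1/4}" for e
  proof -
    \<comment> \<open>Replaces continuity of \<open>h\<close> at \<open>1 / 2\<close>: the point
      \<open>1 / 2 - e\<close> or \<open>1 / 2 + e\<close> divides the segment from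
      \<open>1 / 2\<close> to \<open>b = 1 / 4\<close> or \<open>b = 3 / 4\<close> with weight
      \<open>4 * e\<close> at \<open>b\<close>.\<close>
    have chord: "h ((1 - 4 * e) * (1 / 2) + 4 * e * b) \<ge> (1 - 4 * e) * h (1 / 2) + 4 * e * h b"
      if "b \<in> {0<..<1}" for b
    proof -
      have "1 - 4 * e \<ge> 0" "4 * e \<ge> 0" "1 - 4 * e + 4 * e = 1" "(1 / 2 :: real) \<in> {0<..<1}"
        using e by auto
      then show ?thesis
        using conc that unfolding concave_on_iff real_scaleR_def by blast
    qed
    have "h (1 / 2 - e) \<ge> (1 - 4 * e) * h (1 / 2) + 4 * e * h (1 / 4)"
      using chord[of "1 / 4"] by (simp add: algebra_simps)
    moreover have "h (1 / 2 + e) \<ge> (1 - 4 * e) * h (1 / 2) + 4 * e * h (3 / 4)"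
      using chord[of "3 / 4"] by (simp add: algebra_simps)
    moreover have "h e + h (1 / 2 - e) \<le> 2 * h (1 / 4)"
      using concave_on_midpoint[OF conc, of e "1 / 2 - e"] e by simp
    moreover have "h (1 - e) + h (1 / 2 + e) \<le> 2 * h (3 / 4)"
      using concave_on_midpoint[OF conc, of "1 - e" "1 / 2 + e"] e by simp
    moreover have "h (1 - e) + h e \<ge> 1"
      using h_sum[of e] e by simp
    ultimately show ?thesis
      unfolding S_def by (simp add: algebra_simps)
  qed
  have ev: "\<forall>\<^sub>F e in at_right 0. 1 + (2 - 8 * e) * h (1 / 2) \<le> (2 - 4 * e) * S"
    using approx by (intro eventually_at_rightI[of 0 "1 / 4"]) auto
  have "((\<lambda>e. 1 + (2 - 8 * e) * h (1 / 2)) \<longlongrightarrow> 1 + (2 - 8 * 0) * h (1 / 2)) (at_right 0)"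
    "((\<lambda>e. (2 - 4 * e) * S) \<longlongrightarrow> (2 - 4 * 0) * S) (at_right 0)"
    by (intro tendsto_intros)+
  from tendsto_le[OF _ this(2,1) ev] show ?thesis
    by (simp add: S_def)
qed

lemma h_convex_onD:
  assumes "h_convex_on h I f" "x \<in> I" "y \<in> I" "l \<in> {0<..<1}"
  shows "f ((1 - l) * x + l * y) \<le> h (1 - l) * f x + h l * f y"
  using assms unfolding h_convex_on_def by blast

lemma h_convex_on_midpoint:
  assumes "h_convex_on h I f" "x \<in> I" "y \<in> I"
  shows "f ((x + y) / 2) \<le> h (1 / 2) * (f x + f y)"
  using h_convex_onD[OF assms, of "1 / 2"] by (simp add: add_divide_distrib algebra_simps)

lemma popoviciu_same_side:
  fixes h f :: "real \<Rightarrow> real" and x y z m :: real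
  assumes conc: "concave_on {0<..<1} h"
    and nonneg: "\<And>t. t \<in> I \<Longrightarrow> f t \<ge> 0"
    and hconv: "h_convex_on h I f"
    and I: "x \<in> I" "y \<in> I" "z \<in> I" "m \<in> I"
    and mean: "x + y + z = 3 * m"
    and side: "x < m \<and> y < m \<or> x > m \<and> y > m"
  shows "f ((x + y) / 2) + f ((y + z) / 2) + f ((z + x) / 2)
           \<le> max (h (1 / 2)) (2 * h (1 / 4)) * (f x + f y + f z) + 2 * h (3 / 4) * f m"
proof -
  \<comment> \<open>The entry \<open>h (1 / 2)\<close> will bound the coefficient of
    \<open>f x + f y\<close>, the entry \<open>2 * h (1 / 4)\<close> that of
    \<open>f z\<close>.\<close>
  define M where "M = max (h (1 / 2)) (2 * h (1 / 4))"
  \<comment> \<open>These are the weights at \<open>z\<close> when \<open>(z + x) / 2\<close> and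
    \<open>(y + z) / 2\<close> are written as convex combinations of \<open>m\<close> and
    \<open>z\<close>.\<close>
  define p q where "p = (m - y) / (2 * (z - m))" and "q = (m - x) / (2 * (z - m))"
  have zm: "z - m = (m - x) + (m - y)"
    using mean by argo
  then have nz: "z - m \<noteq> 0"
    using side by linarith
  \<comment> \<open>This is the source of the constants: \<open>p\<close> and \<open>q\<close>
    average to \<open>1 / 4\<close>, their complements to \<open>3 / 4\<close>.\<close>
  have pq: "p + q = 1 / 2"
    using nz zm by (simp add: p_def q_def add_divide_distrib[symmetric] add.commute)
  have "p > 0" "q > 0"
    using side zm by (auto simp: p_def q_def zero_less_divide_iff)
  then have pq01: "p \<in> {0<..<1}" "q \<in> {0<..<1}" "1 - p \<in> {0<..<1}" "1 - q \<in> {0<..<1}"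
    using pq by auto
  have "p * (z - m) = (m - y) / 2" "q * (z - m) = (m - x) / 2"
    using nz by (simp_all add: p_def q_def divide_simps)
  moreover have "(1 - p) * m + p * z = m + p * (z - m)" "(1 - q) * m + q * z = m + q * (z - m)"
    by (simp_all add: algebra_simps)
  ultimately have eqs: "(1 - p) * m + p * z = (z + x) / 2" "(1 - q) * m + q * z = (y + z) / 2"
    using zm by argo+
  have "f ((z + x) / 2) \<le> h (1 - p) * f m + h p * f z"
    using h_convex_onD[OF hconv I(4,3) pq01(1)] unfolding eqs .
  moreover have "f ((y + z) / 2) \<le> h (1 - q) * f m + h q * f z"
    using h_convex_onD[OF hconv I(4,3) pq01(2)] unfolding eqs .
  moreover have "(h (1 - p) + h (1 - q)) * f m \<le> (2 * h (3 / 4)) * f m"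
  proof (rule mult_right_mono)
    have "(1 - p + (1 - q)) / 2 = 3 / 4"
      using pq by argo
    then show "h (1 - p) + h (1 - q) \<le> 2 * h (3 / 4)"
      using concave_on_midpoint[OF conc pq01(3,4)] by (simp only:)
  qed (use nonneg I in auto)
  moreover have "(h p + h q) * f z \<le> M * f z"
  proof (rule mult_right_mono)
    show "h p + h q \<le> M"
      using concave_on_midpoint[OF conc pq01(1,2)] pq by (simp add: M_def)
  qed (use nonneg I in auto)
  moreover have "f ((x + y) / 2) \<le> h (1 / 2) * (f x + f y)"
    by (rule h_convex_on_midpoint[OF hconv I(1,2)])
  moreover have "h (1 / 2) * (f x + f y) \<le> M * (f x + f y)"
    by (rule mult_right_mono) (use nonneg I in \<open>auto simp: M_def\<close>)
  ultimately show ?thesis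
    unfolding M_def[symmetric] by (simp add: algebra_simps)
qed

text \<open>The midpoint of \<open>x\<close> and \<open>y\<close> is \<open>m\<close> itself, so it
  contributes \<open>f m\<close> with coefficient \<open>1\<close>; midpoint
  \<open>h\<close>-convexity on the other two pairs adds \<open>2 * h (1 / 2)\<close>.\<close>

lemma popoviciu_at_mean:
  fixes h f :: "real \<Rightarrow> real" and x y m :: real
  assumes h_sum: "\<And>l. l \<in> {0<..<1} \<Longrightarrow> h (1 - l) + h l \<ge> 1"
    and conc: "concave_on {0<..<1} h"
    and nonneg: "\<And>t. t \<in> I \<Longrightarrow> f t \<ge> 0"
    and hconv: "h_convex_on h I f"
    and I: "x \<in> I" "y \<in> I" "m \<in> I"
    and mean: "x + y = 2 * m"
  shows "f ((x + y) / 2) + f ((y + m) / 2) + f ((m + x) / 2)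
           \<le> max (h (1 / 2)) (2 * h (1 / 4)) * (f x + f y + f m) + 2 * h (3 / 4) * f m"
proof -
  define M where "M = max (h (1 / 2)) (2 * h (1 / 4))"
  have "f ((x + y) / 2) = f m"
    using mean by simp
  moreover have "f ((y + m) / 2) \<le> h (1 / 2) * (f y + f m)" "f ((m + x) / 2) \<le> h (1 / 2) * (f m + f x)"
    by (intro h_convex_on_midpoint[OF hconv] I)+
  moreover have "h (1 / 2) * (f x + f y) \<le> M * (f x + f y)"
    by (rule mult_right_mono) (use nonneg I in \<open>auto simp: M_def\<close>)
  \<comment> \<open>Here the entry \<open>2 * h (1 / 4)\<close> of the maximum is the one
    used.\<close>
  moreover have "(1 + 2 * h (1 / 2)) * f m \<le> (M + 2 * h (3 / 4)) * f m"
    using concave_quarter_points[OF h_sum conc] nonneg[OF I(3)]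
    by (intro mult_right_mono) (auto simp: M_def)
  ultimately show ?thesis
    unfolding M_def[symmetric] by (simp add: algebra_simps)
qed

theorem theorem3:
  fixes I :: "real set" and h f :: "real \<Rightarrow> real" and x y z :: real
  assumes "is_interval I"
    and "\<And>l. l \<in> {0<..<1} \<Longrightarrow> h l > 0"
    and "\<And>l. l \<in> {0<..<1} \<Longrightarrow> h (1 - l) + h l \<ge> 1"
    and "concave_on {0<..<1} h"
    and "\<And>t. t \<in> I \<Longrightarrow> f t \<ge> 0"
    and "h_convex_on h I f"
    and "x \<in> I" and "y \<in> I" and "z \<in> I"
  shows "max (h (1 / 2)) (2 * h (1 / 4)) * (f x + f y + f z) + 2 * h (3 / 4) * f ((x + y + z) / 3)
           \<ge> f ((x + y) / 2) + f ((y + z) / 2) + f ((z + x) / 2)"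
proof -
  define m where "m = (x + y + z) / 3"
  have "min x (min y z) \<in> I" "max x (max y z) \<in> I"
    using assms(7-9) by (auto simp: min_def max_def)
  moreover have "min x (min y z) \<le> m" "m \<le> max x (max y z)"
    by (auto simp: m_def)
  ultimately have mI: "m \<in> I"
    using assms(1) mem_is_interval_1_I by blast
  have perm: "x + y + z = 3 * m" "y + z + x = 3 * m" "z + x + y = 3 * m"
    by (simp_all add: m_def)
  note same = popoviciu_same_side[OF assms(4,5,6)]
  note mean = popoviciu_at_mean[OF assms(3,4,5,6)]
  \<comment> \<open>Pigeonhole: if no point equals \<open>m\<close>, two of the three lie strictly
    on one side of it. Cyclic symmetry then reduces each case to one of the two lemmas.\<close>
  consider "x < m \<and> y < m \<or> x > m \<and> y > m" | "y < m \<and> z < m \<or> y > m \<and> z > m"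
    | "z < m \<and> x < m \<or> z > m \<and> x > m" | "x = m" | "y = m" | "z = m"
    by linarith
  then have "f ((x + y) / 2) + f ((y + z) / 2) + f ((z + x) / 2)
      \<le> max (h (1 / 2)) (2 * h (1 / 4)) * (f x + f y + f z) + 2 * h (3 / 4) * f m"
  proof cases
    case 1
    then show ?thesis
      using same[of x y z m] mI assms(7-9) perm by simp
  next
    case 2
    then show ?thesis
      using same[of y z x m] mI assms(7-9) perm by (simp add: add_ac)
  next
    case 3
    then show ?thesis
      using same[of z x y m] mI assms(7-9) perm by (simp add: add_ac)
  next
    case 4
    then have "y + z = 2 * m"
      using perm by argo
    then show ?thesis
      using mean[of y z m] mI assms(7-9) 4 by (simp add: add_ac)
  next
    case 5
    then have "z + x = 2 * m"
      using perm by argo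
    then show ?thesis
      using mean[of z x m] mI assms(7-9) 5 by (simp add: add_ac)
  next
    case 6
    then have "x + y = 2 * m"
      using perm by argo
    then show ?thesis
      using mean[of x y m] mI assms(7-9) 6 by (simp add: add_ac)
  qed
  then show ?thesis
    by (simp add: m_def)
qed

end
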